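(* Let $d\geq 3$ be a fixed integer and let $\Delta\geq 3$ be a real number. Up to combinatorial equivalence, there are only finitely many Forman--Ricci-positive $d$-dimensional polytopes whose average vertex degree (in the graph of the polytope) is at most $\Delta$.
   Context: Polytopes are convex polytopes, considered up to combinatorial equivalence. The graph of a polytope has its vertices and edges. For an edge $e$ of a polytope $P$, let $\mathcal{F}\uparrow(e)$ be the set of $2$-faces of $P$ containing $e$. Two distinct edges $e,e'$ are parallel neighbors if either (i) they share a vertex but are not contained in a common $2$-face, or (ii) they are vertex-disjoint but are contained in a common $2$-face. Let $\mathcal{E}(e)$ be the set of parallel neighbors of $e$. The Forman--Ricci curvature of $e$ is $\mathcal{F}(e)=|\mathcal{F}\uparrow(e)|+2-|\mathcal{E}(e)|$. A polytope is Forman--Ricci-positive if $\mathcal{F}(e)>0$ for every edge $e$. *)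

theory Defs
  imports "HOL-Analysis.Analysis"
begin

text \<open>Combinatorial equivalence is an isomorphism of face lattices, which include the empty face
  and the polytope itself. The ambient spaces may differ.\<close>

definition combinatorially_equivalent ::
    "'a::euclidean_space set \<Rightarrow> 'b::euclidean_space set \<Rightarrow> bool" where
  "combinatorially_equivalent P Q \<longleftrightarrow>
     (\<exists>\<phi>. bij_betw \<phi> {F. F face_of P} {G. G face_of Q} \<and>
          (\<forall>F F'. F face_of P \<longrightarrow> F' face_of P \<longrightarrow> (F \<subseteq> F' \<longleftrightarrow> \<phi> F \<subseteq> \<phi> F')))"

definition combinatorial_equivalence_on ::
    "'a::euclidean_space set set \<Rightarrow> ('a set \<times> 'a set) set" where
  "combinatorial_equivalence_on A = {(P, Q). P \<in> A \<and> Q \<in> A \<and> combinatorially_equivalent P Q}"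

definition two_faces_above :: "'a::euclidean_space set \<Rightarrow> 'a set \<Rightarrow> 'a set set" where
  "two_faces_above P e = {F. F face_of P \<and> aff_dim F = 2 \<and> e \<subseteq> F}"

definition share_vertex :: "'a::euclidean_space set \<Rightarrow> 'a set \<Rightarrow> 'a set \<Rightarrow> bool" where
  "share_vertex P e e' \<longleftrightarrow> (\<exists>v. v extreme_point_of P \<and> v \<in> e \<and> v \<in> e')"

definition in_common_two_face :: "'a::euclidean_space set \<Rightarrow> 'a set \<Rightarrow> 'a set \<Rightarrow> bool" where
  "in_common_two_face P e e' \<longleftrightarrow> (\<exists>F. F face_of P \<and> aff_dim F = 2 \<and> e \<subseteq> F \<and> e' \<subseteq> F)"

definition parallel_neighbors :: "'a::euclidean_space set \<Rightarrow> 'a set \<Rightarrow> 'a set set" where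
  "parallel_neighbors P e =
     {e'. e' edge_of P \<and> e' \<noteq> e \<and>
          (share_vertex P e e' \<and> \<not> in_common_two_face P e e' \<or>
           \<not> share_vertex P e e' \<and> in_common_two_face P e e')}"

definition forman_ricci_curvature :: "'a::euclidean_space set \<Rightarrow> 'a set \<Rightarrow> int" where
  "forman_ricci_curvature P e =
     int (card (two_faces_above P e)) + 2 - int (card (parallel_neighbors P e))"

definition forman_ricci_positive :: "'a::euclidean_space set \<Rightarrow> bool" where
  "forman_ricci_positive P \<longleftrightarrow> (\<forall>e. e edge_of P \<longrightarrow> forman_ricci_curvature P e > 0)"

text \<open>A vertex of \<open>P\<close> lies on an edge of \<open>P\<close> iff it is one of the two endpoints of that edge.\<close>

definition vertex_degree :: "'a::euclidean_space set \<Rightarrow> 'a \<Rightarrow> nat" where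
  "vertex_degree P v = card {e. e edge_of P \<and> v \<in> e}"

definition average_vertex_degree :: "'a::euclidean_space set \<Rightarrow> real" where
  "average_vertex_degree P =
     (\<Sum>v\<in>{v. v extreme_point_of P}. real (vertex_degree P v)) / real (card {v. v extreme_point_of P})"

lemma combinatorially_equivalent_refl: "combinatorially_equivalent P P"
  unfolding combinatorially_equivalent_def by (rule exI[of _ id]) simp

lemma combinatorially_equivalent_sym:
  assumes "combinatorially_equivalent P Q"
  shows "combinatorially_equivalent Q P"
proof -
  obtain \<phi> where b: "bij_betw \<phi> {F. F face_of P} {G. G face_of Q}"
    and o: "\<And>F F'. F face_of P \<Longrightarrow> F' face_of P \<Longrightarrow> (F \<subseteq> F' \<longleftrightarrow> \<phi> F \<subseteq> \<phi> F')"
    using assms unfolding combinatorially_equivalent_def by blast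
  let ?\<psi> = "inv_into {F. F face_of P} \<phi>"
  have mem: "?\<psi> G face_of P" and inv: "\<phi> (?\<psi> G) = G" if "G face_of Q" for G
    using that bij_betw_apply[OF bij_betw_inv_into[OF b], of G] bij_betw_inv_into_right[OF b, of G]
    by simp_all
  show ?thesis
    unfolding combinatorially_equivalent_def
    using bij_betw_inv_into[OF b] mem inv o by (intro exI[of _ ?\<psi>]) simp
qed

lemma combinatorially_equivalent_trans:
  assumes "combinatorially_equivalent P Q" "combinatorially_equivalent Q R"
  shows "combinatorially_equivalent P R"
proof -
  obtain \<phi> where b: "bij_betw \<phi> {F. F face_of P} {G. G face_of Q}"
    and o: "\<And>F F'. F face_of P \<Longrightarrow> F' face_of P \<Longrightarrow> (F \<subseteq> F' \<longleftrightarrow> \<phi> F \<subseteq> \<phi> F')"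
    using assms(1) unfolding combinatorially_equivalent_def by blast
  obtain \<psi> where b': "bij_betw \<psi> {F. F face_of Q} {G. G face_of R}"
    and o': "\<And>F F'. F face_of Q \<Longrightarrow> F' face_of Q \<Longrightarrow> (F \<subseteq> F' \<longleftrightarrow> \<psi> F \<subseteq> \<psi> F')"
    using assms(2) unfolding combinatorially_equivalent_def by blast
  have mem: "\<phi> F face_of Q" if "F face_of P" for F
    using bij_betw_apply[OF b, of F] that by simp
  show ?thesis
    unfolding combinatorially_equivalent_def
    using bij_betw_trans[OF b b'] o o' mem by (intro exI[of _ "\<psi> \<circ> \<phi>"]) simp
qed

lemma equiv_combinatorial_equivalence_on: "equiv A (combinatorial_equivalence_on A)"
  unfolding combinatorial_equivalence_on_def
  by (intro equivI refl_onI symI transI subsetI)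
     (auto intro: combinatorially_equivalent_refl combinatorially_equivalent_sym
       dest: combinatorially_equivalent_trans)

end

theory Submission
  imports Defs
begin

text \<open>Let \<open>\<delta>\<close> be the graph distance from a vertex \<open>x\<^sub>0\<close>, and
  \<open>\<Phi>(x) = (\<Sum>w \<sim> x. \<delta>(w) - \<delta>(x))\<close>. Along an edge \<open>e = uv\<close> with \<open>\<delta>(v) = \<delta>(u) + 1\<close>,
  each 2-face containing \<open>e\<close> pairs an edge at \<open>u\<close> with an edge at \<open>v\<close>, and one finds
  \<open>\<Phi>(v) \<le> \<Phi>(u) - \<F>(e)\<close>. Since \<open>\<bar>\<Phi>(x)\<bar>\<close> is at most the degree of \<open>x\<close>, positive curvature gives
  \<open>\<delta>(y) \<le> deg x\<^sub>0 + deg y\<close>. Take for \<open>x\<^sub>0\<close> a vertex of degree at most \<open>\<Delta>\<close>: vertices far from \<open>x\<^sub>0\<close>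
  have large degree, so at least half of all vertices lie in a ball around \<open>x\<^sub>0\<close> of radius about
  \<open>3 \<Delta>\<close>. Positive curvature also forces \<open>deg v \<le> 2 deg u\<close> along edges, which bounds the size of
  this ball, hence the number of vertices, in terms of \<open>\<Delta>\<close> alone.\<close>

section \<open>Edges and the graph of a polytope\<close>

definition vertices :: "'a::euclidean_space set \<Rightarrow> 'a set" where
  "vertices P = {v. v extreme_point_of P}"

definition adj :: "'a::euclidean_space set \<Rightarrow> 'a \<Rightarrow> 'a \<Rightarrow> bool" where
  "adj P u v \<longleftrightarrow> closed_segment u v edge_of P"

lemma adj_sym: "adj P u v \<Longrightarrow> adj P v u"
  by (simp add: adj_def closed_segment_commute)

lemma adj_neq: "adj P u v \<Longrightarrow> u \<noteq> v"
  by (auto simp: adj_def edge_of_def)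

lemma adj_vertices: "adj P u v \<Longrightarrow> u \<in> vertices P \<and> v \<in> vertices P"
  by (auto simp: adj_def edge_of_def vertices_def dest: segment_face_of)

lemma finite_vertices: "polytope P \<Longrightarrow> finite (vertices P)"
  unfolding vertices_def by (intro finite_polyhedron_extreme_points polytope_imp_polyhedron)

lemma vertices_subset: "vertices P \<subseteq> P"
  by (auto simp: vertices_def extreme_point_of_def)

lemma polytope_hull_vertices:
  assumes "polytope P"
  shows "convex hull (vertices P) = P"
  using Krein_Milman_Minkowski[of P] assms
  by (simp add: vertices_def polytope_imp_compact polytope_imp_convex)

lemma vertices_face: "F face_of P \<Longrightarrow> vertices F = vertices P \<inter> F"
  by (auto simp: vertices_def extreme_point_of_face)

lemma adj_face:
  assumes "F face_of P"
  shows "adj F u v \<longleftrightarrow> adj P u v \<and> u \<in> F \<and> v \<in> F"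
proof -
  have "closed_segment u v \<subseteq> F \<longleftrightarrow> u \<in> F \<and> v \<in> F"
    using face_of_imp_convex[OF assms] by (meson closed_segment_subset ends_in_segment subsetD)
  then show ?thesis
    unfolding adj_def edge_of_def face_of_face[OF assms] by blast
qed

text \<open>A one-dimensional face is compact, convex and collinear, hence a segment.\<close>

lemma edge_ends:
  assumes "polytope P" "e edge_of P"
  obtains a b where "e = closed_segment a b" "adj P a b"
proof -
  have e: "e face_of P" "aff_dim e = 1" using assms by (auto simp: edge_of_def)
  have p: "polytope e" using face_of_polytope_polytope assms e by blast
  have "e \<noteq> {}" using e by auto
  moreover have "collinear e" using e by (simp add: collinear_aff_dim)
  ultimately obtain a b where "e = closed_segment a b"
    using compact_convex_collinear_segment p polytope_imp_compact polytope_imp_convex by metis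
  then show ?thesis using that assms by (auto simp: adj_def)
qed

lemma edge_through_vertex:
  assumes "polytope P" "e edge_of P" "v \<in> vertices P" "v \<in> e"
  obtains w where "e = closed_segment v w" "adj P v w"
proof -
  obtain a b where ab: "e = closed_segment a b" "adj P a b" by (rule edge_ends[OF assms(1,2)])
  have "v extreme_point_of e"
    using assms by (auto simp: edge_of_def vertices_def extreme_point_of_face)
  then have "v = a \<or> v = b" using ab by (simp add: extreme_point_of_segment)
  then show ?thesis using that ab by (metis adj_sym closed_segment_commute)
qed

lemma edge_vertex:
  assumes "adj P u v" "w \<in> vertices P" "w \<in> closed_segment u v"
  shows "w = u \<or> w = v"
  using assms by (metis adj_def edge_of_def extreme_point_of_face extreme_point_of_segment mem_Collect_eq vertices_def)

lemma adj_segment_inj: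
  assumes "adj P u v" "adj P u w" "closed_segment u v = closed_segment u w"
  shows "v = w"
  using assms by (metis adj_neq adj_vertices edge_vertex ends_in_segment(2))

text \<open>Passing to a proper face of a convex set strictly lowers the dimension.\<close>

lemma equal_dim_face_eq:
  assumes "convex P" "E face_of P" "F face_of P" "E \<subseteq> F" "aff_dim E = aff_dim F"
  shows "E = F"
  by (metis assms face_of_aff_dim_lt face_of_face face_of_imp_convex less_irrefl)

section \<open>Cutting off a vertex by a hyperplane\<close>

text \<open>Faces of a polytope are exposed, so some functional is maximal over \<open>P\<close> at
  \<open>v\<close> alone. Since there are only finitely many other vertices, a threshold fits
  strictly between; negation gives the stated signs.\<close>

lemma separate_vertex:
  assumes "polytope P" "v \<in> vertices P"
  obtains a \<beta> where "a \<bullet> v < \<beta>" "\<And>x. x \<in> vertices P \<Longrightarrow> x \<noteq> v \<Longrightarrow> a \<bullet> x > \<beta>"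
proof -
  have "{v} face_of P" using assms by (simp add: vertices_def face_of_singleton)
  then have "{v} exposed_face_of P"
    using assms exposed_face_of_polyhedron polytope_imp_polyhedron by blast
  then obtain c b where cb: "P \<subseteq> {x. c \<bullet> x \<le> b}" "{v} = P \<inter> {x. c \<bullet> x = b}"
    unfolding exposed_face_of_def by blast
  have lt: "c \<bullet> x < b" if "x \<in> vertices P" "x \<noteq> v" for x
    using cb that vertices_subset[of P] by (smt (verit) IntI mem_Collect_eq singletonD subsetD)
  have cv: "c \<bullet> v = b" using cb by blast
  \<comment> \<open>The extra element \<open>b-1\<close> keeps the set nonempty when
    \<open>v\<close> is the only vertex, and it lies below \<open>b\<close> as the others
    do.\<close>
  let ?S = "insert (b-1) ((\<lambda>x. c \<bullet> x) ` (vertices P - {v}))"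
  have fin: "finite ?S" using finite_vertices assms by blast
  have "Max ?S < b" using fin lt by auto
  then obtain m where m: "Max ?S < m" "m < b" using dense by blast
  have "c \<bullet> x < m" if "x \<in> vertices P" "x \<noteq> v" for x
    using Max_ge[OF fin, of "c \<bullet> x"] that m(1) by (meson DiffI image_eqI insertCI le_less_trans singletonD)
  then show ?thesis using that[of "-c" "-m"] m cv by auto
qed

text \<open>In a minimal face through \<open>q\<close>, the point cannot be on the relative
  boundary: that boundary is a union of facets, each a smaller face of \<open>P\<close>.\<close>

lemma minimal_face_point:
  fixes P :: "'a::euclidean_space set"
  assumes "polytope P" "q \<in> P"
  obtains F where "F face_of P" "q \<in> rel_interior F"
proof -
  let ?S = "{F. F face_of P \<and> q \<in> F}"
  have "finite ?S" using finite_polytope_faces[OF assms(1)] by simp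
  moreover have "P \<in> ?S" using assms polytope_imp_convex face_of_refl by blast
  then have "?S \<noteq> {}" by blast
  ultimately have "\<exists>F\<in>?S. \<forall>G\<in>?S. G \<subseteq> F \<longrightarrow> F = G" by (rule finite_has_minimal)
  then obtain F where F: "F \<in> ?S" and min: "\<And>G. G \<in> ?S \<Longrightarrow> G \<subseteq> F \<Longrightarrow> F = G" by blast
  have FP: "F face_of P" "q \<in> F" using F by auto
  then have "polyhedron F" using assms face_of_polytope_polytope polytope_imp_polyhedron by blast
  have "q \<in> rel_interior F"
  proof (rule ccontr)
    assume "q \<notin> rel_interior F"
    then obtain G where G: "G facet_of F" "q \<in> G"
      using rel_boundary_of_polyhedron[OF \<open>polyhedron F\<close>] FP by blast
    have "G face_of P" using facet_of_imp_face_of[OF G(1)] FP(1) by (rule face_of_trans)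
    then have "F = G" using min G facet_of_imp_subset by blast
    then show False using G by simp
  qed
  then show ?thesis using that FP by blast
qed

text \<open>The face \<open>F\<close> with \<open>q\<close> in its relative interior must be an
  edge. In dimension at least 2 the hyperplane would cut \<open>F\<close> in a segment around
  \<open>q\<close>, contradicting extremality; in dimension 0, \<open>q\<close> would be a vertex of
  \<open>P\<close> on the hyperplane. As the hyperplane separates \<open>v\<close> from all other
  vertices, an edge crossing it ends at \<open>v\<close>.\<close>

lemma vertex_figure_vertex:
  assumes P: "polytope P" and v: "v \<in> vertices P" "a \<bullet> v < \<beta>"
    and sep: "\<And>x. x \<in> vertices P \<Longrightarrow> x \<noteq> v \<Longrightarrow> a \<bullet> x > \<beta>"
    and q: "q extreme_point_of (P \<inter> {x. a \<bullet> x = \<beta>})"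
  obtains w where "adj P v w" "q \<in> closed_segment v w"
proof -
  have qP: "q \<in> P" "a \<bullet> q = \<beta>" using q by (auto simp: extreme_point_of_def)
  obtain F where F: "F face_of P" "q \<in> rel_interior F" using minimal_face_point[OF P qP(1)] by metis
  have qF: "q \<in> F" using F rel_interior_subset by blast
  obtain d where d: "d > 0" "cball q d \<inter> affine hull F \<subseteq> F"
    using F(2) mem_rel_interior_cball by blast
  have "aff_dim F \<le> 1"
  proof (rule ccontr)
    assume "\<not> aff_dim F \<le> 1"
    let ?T = "affine hull F \<inter> {x. a \<bullet> x = \<beta>}"
    have "q \<in> ?T" using qF qP by (simp add: hull_inc)
    \<comment> \<open>A hyperplane section through \<open>q\<close> costs at most one
      dimension.\<close>
    then have "aff_dim ?T \<ge> 1"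
      using aff_dim_affine_Int_hyperplane[of "affine hull F" a \<beta>] \<open>\<not> aff_dim F \<le> 1\<close> by auto
    then have "\<not> ?T \<subseteq> {q}" using aff_dim_subset[of ?T "{q}"] by auto
    then obtain y where y: "y \<in> ?T" "y \<noteq> q" by blast
    \<comment> \<open>With this \<open>t\<close> the two points \<open>?p\<close> and
      \<open>?p'\<close> lie at distance exactly \<open>d\<close> from \<open>q\<close>, on opposite
      sides, and so still in \<open>F\<close>.\<close>
    define t where "t = d / norm (y - q)"
    have t: "t > 0" "norm (t *\<^sub>R (y - q)) = d" using y d by (auto simp: t_def)
    let ?p = "q + t *\<^sub>R (y - q)" and ?p' = "q + (-t) *\<^sub>R (y - q)"
    have aff: "q + s *\<^sub>R (y - q) \<in> ?T" for s
    proof -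
      have "affine ?T" by (intro affine_Int affine_affine_hull affine_hyperplane)
      then have "(1 - s) *\<^sub>R q + s *\<^sub>R y \<in> ?T" using y \<open>q \<in> ?T\<close> unfolding affine_def by auto
      then show ?thesis by (simp add: algebra_simps)
    qed
    have "?p \<in> cball q d" "?p' \<in> cball q d" using t(2) by (simp_all add: dist_norm)
    then have ends: "?p \<in> P \<inter> {x. a \<bullet> x = \<beta>}" "?p' \<in> P \<inter> {x. a \<bullet> x = \<beta>}"
      using aff[of t] aff[of "-t"] d(2) face_of_imp_subset[OF F(1)] by blast+
    have between: "q \<in> open_segment ?p ?p'"
    proof -
      have "?p \<noteq> ?p'"
        unfolding add_left_cancel scaleR_cancel_right using t(1) y(2) by simp
      moreover have mid: "midpoint ?p ?p' = q"
        unfolding midpoint_eq_iff by simp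
      ultimately show ?thesis
        using iffD2[OF midpoint_in_open_segment[of ?p ?p']] by (simp only: mid not_False_eq_True)
    qed
    have ext: "\<forall>x\<in>P \<inter> {x. a \<bullet> x = \<beta>}. \<forall>y\<in>P \<inter> {x. a \<bullet> x = \<beta>}. q \<notin> open_segment x y"
      using q unfolding extreme_point_of_def by (rule conjunct2)
    show False by (rule notE[OF bspec[OF bspec[OF ext ends(1)] ends(2)] between])
  qed
  moreover have "\<not> aff_dim F < 0"
    unfolding aff_dim_negative_iff using qF by auto
  moreover have "aff_dim F \<noteq> 0"
  proof
    assume "aff_dim F = 0"
    then obtain z where "F = {z}" unfolding aff_dim_eq_0 by (rule exE)
    then have "F = {q}" using qF by simp
    then have "q \<in> vertices P" using F by (simp add: vertices_def face_of_singleton)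
    then show False using sep[of q] qP v by auto
  qed
  ultimately have "aff_dim F = 1" by linarith
  then have "F edge_of P" using F(1) by (simp add: edge_of_def)
  then obtain x y where xy: "F = closed_segment x y" "adj P x y" by (rule edge_ends[OF P])
  have "x = v \<or> y = v"
  proof (rule ccontr)
    assume "\<not> ?thesis"
    then have "{x, y} \<subseteq> {z. a \<bullet> z > \<beta>}" using sep adj_vertices[OF xy(2)] by auto
    then have "closed_segment x y \<subseteq> {z. a \<bullet> z > \<beta>}"
      by (intro closed_segment_subset convex_halfspace_gt) auto
    then show False using qF qP xy by auto
  qed
  then show ?thesis using that[of x] that[of y] xy qF adj_sym[OF xy(2)] by (auto simp: closed_segment_commute)
qed

text \<open>A polytope lies in the cone spanned at a vertex by its edges: cut the polytope by a hyperplane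
  separating the vertex from the others, and apply Krein--Milman to the section.\<close>

lemma vertex_minimal_if_neighbors:
  assumes P: "polytope P" and v: "v \<in> vertices P"
    and nb: "\<And>w. adj P v w \<Longrightarrow> c \<bullet> v \<le> c \<bullet> w"
    and p: "p \<in> P"
  shows "c \<bullet> v \<le> c \<bullet> p"
proof -
  obtain a \<beta> where a: "a \<bullet> v < \<beta>" "\<And>x. x \<in> vertices P \<Longrightarrow> x \<noteq> v \<Longrightarrow> a \<bullet> x > \<beta>"
    using separate_vertex[OF P v] by metis
  have "c \<bullet> v \<le> c \<bullet> x" if x: "x \<in> vertices P" "x \<noteq> v" for x
  proof -
    let ?Q = "P \<inter> {x. a \<bullet> x = \<beta>}"
    have ax: "a \<bullet> x > \<beta>" using a x by blast
    \<comment> \<open>The parameter at which the segment from \<open>v\<close> to \<open>x\<close>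
      crosses the hyperplane.\<close>
    define s where "s = (\<beta> - a \<bullet> v) / (a \<bullet> x - a \<bullet> v)"
    have s: "0 < s" "s \<le> 1" using ax a by (auto simp: s_def field_simps)
    have "s * (a \<bullet> x - a \<bullet> v) = \<beta> - a \<bullet> v" using ax a by (simp add: s_def)
    then have "a \<bullet> ((1 - s) *\<^sub>R v + s *\<^sub>R x) = \<beta>" by (simp add: algebra_simps)
    moreover have "(1 - s) *\<^sub>R v + s *\<^sub>R x \<in> P"
      using polytope_imp_convex[OF P] x v vertices_subset[of P] s
      by (intro convexD) auto
    ultimately have "(1 - s) *\<^sub>R v + s *\<^sub>R x \<in> ?Q" by simp
    also have "?Q = convex hull {q. q extreme_point_of ?Q}"
      by (intro Krein_Milman_Minkowski compact_Int_closed convex_Int polytope_imp_compact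
          polytope_imp_convex P closed_hyperplane convex_hyperplane)
    also have "\<dots> \<subseteq> {z. c \<bullet> z \<ge> c \<bullet> v}"
    proof (intro hull_minimal convex_halfspace_ge subsetI)
      fix q assume "q \<in> {q. q extreme_point_of ?Q}"
      then obtain w where w: "adj P v w" "q \<in> closed_segment v w"
        using vertex_figure_vertex[OF P v a] by blast
      have "closed_segment v w \<subseteq> {z. c \<bullet> z \<ge> c \<bullet> v}"
        using nb[OF w(1)] by (intro closed_segment_subset convex_halfspace_ge) auto
      then show "q \<in> {z. c \<bullet> z \<ge> c \<bullet> v}" using w by blast
    qed
    finally have "s * (c \<bullet> v) \<le> s * (c \<bullet> x)" by (simp add: algebra_simps)
    then show ?thesis using s by simp
  qed
  then have "vertices P \<subseteq> {z. c \<bullet> z \<ge> c \<bullet> v}" by auto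
  then have "convex hull vertices P \<subseteq> {z. c \<bullet> z \<ge> c \<bullet> v}"
    by (intro hull_minimal convex_halfspace_ge)
  then show ?thesis using p polytope_hull_vertices[OF P] by auto
qed

section \<open>Monotone paths and connectedness\<close>

text \<open>A vertex that is minimal among its neighbors is minimal over \<open>P\<close>, so any
  other vertex has a strictly lower neighbor. The walk ends because the number of strictly lower
  vertices drops.\<close>

lemma descend:
  assumes P: "polytope P" and "u \<in> vertices P"
  shows "\<exists>m. m \<in> vertices P \<and> (\<forall>p\<in>P. c \<bullet> m \<le> c \<bullet> p) \<and>
             (\<lambda>x y. adj P x y \<and> c \<bullet> y < c \<bullet> x)\<^sup>*\<^sup>* u m"
  using assms(2)
proof (induction "card {x \<in> vertices P. c \<bullet> x < c \<bullet> u}" arbitrary: u rule: less_induct)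
  case less
  show ?case
  proof (cases "\<forall>p\<in>P. c \<bullet> u \<le> c \<bullet> p")
    case False
    then obtain w where w: "adj P u w" "c \<bullet> w < c \<bullet> u"
      using vertex_minimal_if_neighbors[OF P less.prems] by (meson not_le)
    have "card {x \<in> vertices P. c \<bullet> x < c \<bullet> w} < card {x \<in> vertices P. c \<bullet> x < c \<bullet> u}"
      using w adj_vertices[OF w(1)] finite_vertices[OF P] by (intro psubset_card_mono) auto
    from less.hyps[OF this] w adj_vertices[OF w(1)] obtain m where "m \<in> vertices P"
      "\<forall>p\<in>P. c \<bullet> m \<le> c \<bullet> p" "(\<lambda>x y. adj P x y \<and> c \<bullet> y < c \<bullet> x)\<^sup>*\<^sup>* w m"
      by blast
    then show ?thesis using w by (metis (no_types, lifting) converse_rtranclp_into_rtranclp)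
  qed (use less.prems in blast)
qed

text \<open>Take a functional maximized over \<open>P\<close> only at \<open>v\<close>; descending
  for its negative from \<open>u\<close> can only stop at \<open>v\<close>.\<close>

lemma graph_connected:
  assumes P: "polytope P" and "u \<in> vertices P" "v \<in> vertices P"
  shows "(adj P)\<^sup>*\<^sup>* u v"
proof -
  have "{v} exposed_face_of P"
    using assms exposed_face_of_polyhedron[OF polytope_imp_polyhedron[OF P]]
    by (simp add: vertices_def face_of_singleton)
  then obtain c b where cb: "P \<subseteq> {x. c \<bullet> x \<le> b}" "{v} = P \<inter> {x. c \<bullet> x = b}"
    unfolding exposed_face_of_def by blast
  obtain m where m: "m \<in> vertices P" "\<forall>p\<in>P. -c \<bullet> m \<le> -c \<bullet> p"
    "(\<lambda>x y. adj P x y \<and> -c \<bullet> y < -c \<bullet> x)\<^sup>*\<^sup>* u m"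
    using descend[OF P assms(2)] by blast
  have "v \<in> P" "c \<bullet> v = b" using cb by blast+
  moreover have "m \<in> P" using m vertices_subset by blast
  ultimately have "c \<bullet> m = b" using m cb(1) by fastforce
  then have "m = v" using cb \<open>m \<in> P\<close> by blast
  then show ?thesis using m(3) by (metis (mono_tags, lifting) mono_rtranclp)
qed

text \<open>Descending from \<open>u\<close> and from \<open>v\<close> never leaves the sublevel
  set. Both descents end in the face where \<open>c\<close> is minimal, and the graph of that face
  is itself connected.\<close>

lemma sublevel_graph_connected:
  assumes P: "polytope P" and u: "u \<in> vertices P" "c \<bullet> u < b" and v: "v \<in> vertices P" "c \<bullet> v < b"
  shows "(\<lambda>x y. adj P x y \<and> c \<bullet> x < b \<and> c \<bullet> y < b)\<^sup>*\<^sup>* u v" (is "?R\<^sup>*\<^sup>* u v")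
proof -
  have down: "\<exists>m \<in> vertices P. (\<forall>p\<in>P. c \<bullet> m \<le> c \<bullet> p) \<and> ?R\<^sup>*\<^sup>* x m"
    if x: "x \<in> vertices P" "c \<bullet> x < b" for x
  proof -
    obtain m where m: "m \<in> vertices P" "\<forall>p\<in>P. c \<bullet> m \<le> c \<bullet> p"
      "(\<lambda>x y. adj P x y \<and> c \<bullet> y < c \<bullet> x)\<^sup>*\<^sup>* x m"
      using descend[OF P x(1)] by blast
    from m(3) have "?R\<^sup>*\<^sup>* x m \<and> c \<bullet> m < b"
    proof (induction rule: rtranclp_induct)
      case (step y z)
      then have R: "?R y z" by auto
      have "?R\<^sup>*\<^sup>* x y" using step.IH by blast
      then have "?R\<^sup>*\<^sup>* x z" using R by (rule rtranclp.rtrancl_into_rtrancl)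
      then show ?case using R by blast
    qed (use x in auto)
    then show ?thesis using m by blast
  qed
  obtain m where m: "m \<in> vertices P" "\<forall>p\<in>P. c \<bullet> m \<le> c \<bullet> p" "?R\<^sup>*\<^sup>* u m" using down u by blast
  obtain n where n: "n \<in> vertices P" "\<forall>p\<in>P. c \<bullet> n \<le> c \<bullet> p" "?R\<^sup>*\<^sup>* v n" using down v by blast
  \<comment> \<open>The face of minimizers. It lies below \<open>b\<close> because its value is at
    most \<open>c \<bullet> u\<close>.\<close>
  define M where "M = P \<inter> {x. c \<bullet> x = c \<bullet> m}"
  have mP: "m \<in> P" "n \<in> P" using m n vertices_subset by blast+
  have M: "M face_of P"
    unfolding M_def using m by (intro face_of_Int_supporting_hyperplane_ge polytope_imp_convex P) auto
  have "c \<bullet> n = c \<bullet> m" using bspec[OF m(2) mP(2)] bspec[OF n(2) mP(1)] by linarith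
  then have "m \<in> vertices M" "n \<in> vertices M"
    using m(1) n(1) mP by (simp_all add: vertices_face[OF M]) (simp_all add: M_def)
  then have "(adj M)\<^sup>*\<^sup>* m n"
    using graph_connected face_of_polytope_polytope P M by blast
  moreover have "(adj M)\<^sup>*\<^sup>* \<le> ?R\<^sup>*\<^sup>*"
  proof (intro rtranclp_mono predicate2I)
    fix x y assume "adj M x y"
    then have "adj P x y" "x \<in> M" "y \<in> M" unfolding adj_face[OF M] by auto
    moreover have "u \<in> P" using u(1) vertices_subset by blast
    then have "c \<bullet> m < b" using bspec[OF m(2), of u] u(2) by linarith
    ultimately show "?R x y" by (simp add: M_def)
  qed
  ultimately have "?R\<^sup>*\<^sup>* m n" by (rule predicate2D[rotated])
  moreover have "symp ?R" by (auto intro!: sympI dest: adj_sym)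
  then have "?R\<^sup>*\<^sup>* n v" by (rule sympD[OF symp_rtranclp n(3)])
  ultimately show ?thesis by (rule rtranclp_trans[OF rtranclp_trans[OF m(3)]])
qed

section \<open>Polygons and paths\<close>

lemma exposing_functional:
  fixes P :: "'a::euclidean_space set"
  assumes "polytope P" "E face_of P"
  obtains c b where "\<And>x. x \<in> P \<Longrightarrow> c \<bullet> x \<le> b" "\<And>x. x \<in> P \<Longrightarrow> x \<in> E \<longleftrightarrow> c \<bullet> x = b"
proof -
  have "E exposed_face_of P"
    using assms exposed_face_of_polyhedron[OF polytope_imp_polyhedron] by blast
  then obtain c b where cb: "P \<subseteq> {x. c \<bullet> x \<le> b}" "E = P \<inter> {x. c \<bullet> x = b}"
    unfolding exposed_face_of_def by blast
  show ?thesis by (rule that[of c b]) (use cb in blast)+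
qed

text \<open>If \<open>v\<close> were the only neighbor of \<open>u\<close>, a functional exposing
  the edge \<open>uv\<close> would be constant on \<open>u\<close> and its neighbors. Then
  \<open>u\<close> would minimize it over \<open>P\<close> as well as maximize it, and
  \<open>P\<close> would reduce to that edge.\<close>

lemma other_neighbor_exists:
  assumes P: "polytope P" and "aff_dim P \<ge> 2" and uv: "adj P u v"
  shows "\<exists>w. adj P u w \<and> w \<noteq> v"
proof (rule ccontr)
  assume none: "\<not> ?thesis"
  let ?E = "closed_segment u v"
  have E: "?E face_of P" "aff_dim ?E = 1" using uv by (auto simp: adj_def edge_of_def)
  obtain c b where c: "\<And>x. x \<in> P \<Longrightarrow> c \<bullet> x \<le> b" "\<And>x. x \<in> P \<Longrightarrow> x \<in> ?E \<longleftrightarrow> c \<bullet> x = b"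
    using exposing_functional[OF P E(1)] by metis
  have uvP: "u \<in> P" "v \<in> P" "u \<in> vertices P"
    using adj_vertices[OF uv] vertices_subset by blast+
  have "c \<bullet> u = b" "c \<bullet> v = b" using c(2) uvP by auto
  then have "c \<bullet> u \<le> c \<bullet> w" if "adj P u w" for w using none that by fastforce
  then have "c \<bullet> u \<le> c \<bullet> p" if "p \<in> P" for p
    using vertex_minimal_if_neighbors[OF P uvP(3)] that by blast
  then have "P \<subseteq> ?E" using c \<open>c \<bullet> u = b\<close> by force
  then show False using aff_dim_subset[of P ?E] E assms by simp
qed

text \<open>Cutting off \<open>u\<close> by a line leaves a section of dimension at most one, a
  segment with at most two extreme points, while distinct edges at \<open>u\<close> give distinct
  extreme points of it.\<close>

lemma polygon_at_most_two_neighbors: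
  assumes P: "polytope P" and dim: "aff_dim P = 2"
    and w: "adj P u w1" "adj P u w2" "adj P u w3" "w1 \<noteq> w2" "w1 \<noteq> w3" "w2 \<noteq> w3"
  shows False
proof -
  have u: "u \<in> vertices P" using adj_vertices w by blast
  obtain a \<beta> where a: "a \<bullet> u < \<beta>" "\<And>x. x \<in> vertices P \<Longrightarrow> x \<noteq> u \<Longrightarrow> a \<bullet> x > \<beta>"
    using separate_vertex[OF P u] by metis
  let ?H = "{x. a \<bullet> x = \<beta>}"
  let ?Q = "P \<inter> ?H"
  have uP: "u \<in> P" using u vertices_subset by blast
  have "aff_dim ?Q \<le> aff_dim (affine hull P \<inter> ?H)"
    by (intro aff_dim_subset) (auto intro: hull_inc)
  \<comment> \<open>The point \<open>u\<close> lies off the hyperplane, so the dimension really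
    drops.\<close>
  also have "\<dots> \<le> 1"
    using aff_dim_affine_Int_hyperplane[of "affine hull P" a \<beta>] dim hull_inc[OF uP, of affine] a(1)
    by auto
  finally have "collinear ?Q" by (simp add: collinear_aff_dim)
  \<comment> \<open>An edge at \<open>u\<close> meets the hyperplane in one point, and the slice of
    a face of \<open>P\<close> is a face of the section.\<close>
  have ex: "\<exists>q s. q extreme_point_of ?Q \<and> q = u + s *\<^sub>R (w - u) \<and> s > 0"
    if w: "adj P u w" for w
  proof -
    have "a \<bullet> w > \<beta>" using a adj_neq[OF w] adj_vertices[OF w] by auto
    define s where "s = (\<beta> - a \<bullet> u) / (a \<bullet> w - a \<bullet> u)"
    have s: "0 < s" "s \<le> 1" using \<open>a \<bullet> w > \<beta>\<close> a by (auto simp: s_def field_simps)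
    have s': "s * (a \<bullet> w - a \<bullet> u) = \<beta> - a \<bullet> u" using \<open>a \<bullet> w > \<beta>\<close> a by (simp add: s_def)
    let ?q = "u + s *\<^sub>R (w - u)"
    have "closed_segment u w \<inter> ?H = {?q}"
    proof
      show "closed_segment u w \<inter> ?H \<subseteq> {?q}"
      proof
        fix x assume x: "x \<in> closed_segment u w \<inter> ?H"
        then obtain t where t: "x = (1 - t) *\<^sub>R u + t *\<^sub>R w" by (auto simp: in_segment)
        have "(1 - t) * (a \<bullet> u) + t * (a \<bullet> w) = \<beta>" using x t by (simp add: inner_add_right)
        then have "t * (a \<bullet> w - a \<bullet> u) = s * (a \<bullet> w - a \<bullet> u)" using s' by (simp add: algebra_simps)
        then have "t = s" using \<open>a \<bullet> w > \<beta>\<close> a by simp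
        then show "x \<in> {?q}" using t by (simp add: algebra_simps)
      qed
      have "?q = (1 - s) *\<^sub>R u + s *\<^sub>R w" by (simp add: algebra_simps)
      then have "?q \<in> closed_segment u w" using s in_segment(1) by force
      moreover have "a \<bullet> ?q = \<beta>" using s' by (simp add: algebra_simps)
      ultimately show "{?q} \<subseteq> closed_segment u w \<inter> ?H" by simp
    qed
    moreover have "closed_segment u w \<inter> ?H face_of ?Q"
      using w by (intro face_of_slice convex_hyperplane) (simp add: adj_def edge_of_def)
    ultimately have "{?q} face_of ?Q" by simp
    then have "?q extreme_point_of ?Q" unfolding face_of_singleton .
    then show ?thesis using s(1) by blast
  qed
  \<comment> \<open>If the crossing points agree, then \<open>w\<close> and \<open>w'\<close> are on
    one ray from \<open>u\<close>; \<open>s \<le> s'\<close> places \<open>w'\<close> on the edge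
    from \<open>u\<close> to \<open>w\<close>, whose only vertices are its ends.\<close>
  have inj: "w = w'"
    if "adj P u w" "adj P u w'" "u + s *\<^sub>R (w - u) = u + s' *\<^sub>R (w' - u)" "s > 0" "s' > 0" "s \<le> s'"
    for w w' s s'
  proof -
    define t where "t = s / s'"
    have t: "0 < t" "t \<le> 1" using that by (auto simp: t_def)
    have "s' *\<^sub>R (w' - u) = s *\<^sub>R (w - u)" using that by simp
    then have "inverse s' *\<^sub>R (s' *\<^sub>R (w' - u)) = inverse s' *\<^sub>R (s *\<^sub>R (w - u))" by simp
    then have "w' - u = t *\<^sub>R (w - u)"
      using that by (simp add: t_def divide_inverse mult.commute)
    then have "w' = (1 - t) *\<^sub>R u + t *\<^sub>R w" by (simp add: algebra_simps)
    then have "w' \<in> closed_segment u w" using t in_segment(1) by force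
    moreover have "w' \<in> vertices P" "w' \<noteq> u"
      using adj_vertices[OF that(2)] adj_neq[OF that(2)] by auto
    ultimately show ?thesis using edge_vertex[OF that(1)] by blast
  qed
  have neq: "u + s *\<^sub>R (w - u) \<noteq> u + s' *\<^sub>R (w' - u)"
    if "adj P u w" "adj P u w'" "w \<noteq> w'" "s > 0" "s' > 0" for w w' s s'
  proof
    assume eq: "u + s *\<^sub>R (w - u) = u + s' *\<^sub>R (w' - u)"
    show False
      using inj[OF that(1,2) eq that(4,5)] inj[OF that(2,1) eq[symmetric] that(5,4)] that(3)
      by (cases "s \<le> s'") auto
  qed
  obtain q1 s1 where q1: "q1 extreme_point_of ?Q" "q1 = u + s1 *\<^sub>R (w1 - u)" "s1 > 0"
    using ex w by blast
  obtain q2 s2 where q2: "q2 extreme_point_of ?Q" "q2 = u + s2 *\<^sub>R (w2 - u)" "s2 > 0"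
    using ex w by blast
  obtain q3 s3 where q3: "q3 extreme_point_of ?Q" "q3 = u + s3 *\<^sub>R (w3 - u)" "s3 > 0"
    using ex w by blast
  have "q1 \<noteq> q2" "q1 \<noteq> q3" "q2 \<noteq> q3"
    unfolding q1(2) q2(2) q3(2) by (intro neq w q1(3) q2(3) q3(3))+
  have "compact ?Q" "convex ?Q"
    by (intro compact_Int_closed convex_Int polytope_imp_compact
          polytope_imp_convex P closed_hyperplane convex_hyperplane)+
  moreover have "?Q \<noteq> {}" using q1 by (auto simp: extreme_point_of_def)
  ultimately obtain x y where xy: "?Q = closed_segment x y"
    using compact_convex_collinear_segment \<open>collinear ?Q\<close> by metis
  have "q1 = x \<or> q1 = y" "q2 = x \<or> q2 = y" "q3 = x \<or> q3 = y"
    using q1(1) q2(1) q3(1) unfolding xy extreme_point_of_segment by simp_all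
  with \<open>q1 \<noteq> q2\<close> \<open>q1 \<noteq> q3\<close> \<open>q2 \<noteq> q3\<close> show False by auto
qed

lemma polygon_other_neighbor:
  assumes "polytope P" "aff_dim P = 2" "adj P u v"
  shows "\<exists>!w. adj P u w \<and> w \<noteq> v"
proof -
  obtain w where w: "adj P u w" "w \<noteq> v"
    using other_neighbor_exists[OF assms(1) _ assms(3)] assms(2) by auto
  have "w' = w" if "adj P u w'" "w' \<noteq> v" for w'
    using polygon_at_most_two_neighbors[OF assms(1,2) assms(3) w(1) that(1)] w(2) that(2) by blast
  then show ?thesis using w by blast
qed

section \<open>Paths avoiding a face\<close>

text \<open>A functional exposing \<open>E\<close> attains its maximum exactly on \<open>E\<close>,
  so the vertices off \<open>E\<close> are those of a strict sublevel set.\<close>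

lemma connected_off_face:
  assumes P: "polytope P" and E: "E face_of P"
    and x: "x \<in> vertices P" "x \<notin> E" and y: "y \<in> vertices P" "y \<notin> E"
  shows "(\<lambda>x y. adj P x y \<and> x \<notin> E \<and> y \<notin> E)\<^sup>*\<^sup>* x y"
proof -
  obtain c b where c: "\<And>x. x \<in> P \<Longrightarrow> c \<bullet> x \<le> b" "\<And>x. x \<in> P \<Longrightarrow> x \<in> E \<longleftrightarrow> c \<bullet> x = b"
    using exposing_functional[OF P E] by metis
  have iff: "z \<notin> E \<longleftrightarrow> c \<bullet> z < b" if "z \<in> vertices P" for z
    using c[of z] that vertices_subset[of P] by fastforce
  have "(\<lambda>x y. adj P x y \<and> c \<bullet> x < b \<and> c \<bullet> y < b)\<^sup>*\<^sup>* x y"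
    using sublevel_graph_connected[OF P] iff x y by blast
  then show ?thesis
    by (rule rtranclp_mono[THEN predicate2D, rotated]) (use iff adj_vertices in blast)
qed

text \<open>Walking from \<open>x\<close> to \<open>y\<close>, an integer-valued 1-Lipschitz function crosses each intermediate level
  along a different edge.\<close>

lemma lipschitz_path_bound:
  fixes \<delta> :: "'a::euclidean_space \<Rightarrow> int"
  assumes "finite M" and path: "R\<^sup>*\<^sup>* x y"
    and R: "\<And>z w. R z w \<Longrightarrow> adj P z w \<and> closed_segment z w \<in> M \<and> \<delta> w \<le> \<delta> z + 1"
  shows "\<delta> y - \<delta> x \<le> int (card M)"
proof -
  \<comment> \<open>The lower of the values of \<delta> at the two ends of an edge: the level that
    the edge crosses when the values differ by one.\<close>
  define \<mu> where "\<mu> e = Min (\<delta> ` (vertices P \<inter> e))" for e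
  have \<mu>: "\<mu> (closed_segment z w) = min (\<delta> z) (\<delta> w)" if "R z w" for z w
  proof -
    have a: "adj P z w" using R that by blast
    have "vertices P \<inter> closed_segment z w = {z, w}"
      using edge_vertex[OF a] adj_vertices[OF a] by auto
    then show ?thesis by (simp add: \<mu>_def)
  qed
  from path have "{\<delta> x..<\<delta> y} \<subseteq> \<mu> ` M"
  proof (induction rule: rtranclp_induct)
    case (step z w)
    \<comment> \<open>A step adds at most the level \<open>\<delta> z\<close>, which the edge
      \<open>zw\<close> itself realizes.\<close>
    have "{\<delta> x..<\<delta> w} \<subseteq> {\<delta> x..<\<delta> z} \<union> (if \<delta> w = \<delta> z + 1 then {\<delta> z} else {})"
      using R[OF step(2)] by auto
    moreover have "\<delta> w = \<delta> z + 1 \<Longrightarrow> \<delta> z \<in> \<mu> ` M"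
      using R[OF step(2)] \<mu>[OF step(2)] by force
    ultimately show ?case using step.IH by (auto split: if_splits)
  qed simp
  then have "card {\<delta> x..<\<delta> y} \<le> card M"
    using surj_card_le assms(1) by blast
  then show ?thesis by simp
qed

section \<open>Curvature and the graph Laplacian\<close>

definition neighbors :: "'a::euclidean_space set \<Rightarrow> 'a \<Rightarrow> 'a set" where
  "neighbors P v = {w. adj P v w}"

text \<open>Well defined when \<open>uv\<close> is an edge of a polygon \<open>F\<close>, where
  \<open>u\<close> has exactly one further neighbor.\<close>

definition next_neighbor :: "'a::euclidean_space set \<Rightarrow> 'a \<Rightarrow> 'a \<Rightarrow> 'a" where
  "next_neighbor F u v = (THE w. adj F u w \<and> w \<noteq> v)"

text \<open>For an edge \<open>uv\<close>, these are the other ends of its parallel neighbors of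
  type (i) at \<open>u\<close>.\<close>

definition stray_neighbors :: "'a::euclidean_space set \<Rightarrow> 'a \<Rightarrow> 'a \<Rightarrow> 'a set" where
  "stray_neighbors P u v =
     {w \<in> neighbors P u. w \<noteq> v \<and> \<not> in_common_two_face P (closed_segment u v) (closed_segment u w)}"

text \<open>For a 2-face \<open>F\<close> containing \<open>e\<close>, these are the parallel
  neighbors of \<open>e\<close> of type (ii) inside \<open>F\<close>.\<close>

definition far_edges :: "'a::euclidean_space set \<Rightarrow> 'a set \<Rightarrow> 'a set \<Rightarrow> 'a set set" where
  "far_edges P e F = {e'. e' edge_of P \<and> e' \<subseteq> F \<and> \<not> share_vertex P e e'}"

lemma finite_neighbors: "polytope P \<Longrightarrow> finite (neighbors P v)"
  by (rule finite_subset[OF _ finite_vertices]) (auto simp: neighbors_def dest: adj_vertices)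

lemma finite_two_faces_above: "polytope P \<Longrightarrow> finite (two_faces_above P e)"
  by (rule finite_subset[OF _ finite_polytope_faces]) (auto simp: two_faces_above_def)

lemma finite_edges: "polytope P \<Longrightarrow> finite {e. e edge_of P}"
  by (rule finite_subset[OF _ finite_polytope_faces]) (auto simp: edge_of_def)

lemma vertex_degree_neighbors:
  assumes "polytope P" "v \<in> vertices P"
  shows "vertex_degree P v = card (neighbors P v)"
proof -
  have "bij_betw (closed_segment v) (neighbors P v) {e. e edge_of P \<and> v \<in> e}"
  proof (rule bij_betw_imageI)
    show "inj_on (closed_segment v) (neighbors P v)"
      by (rule inj_onI, rule adj_segment_inj[of P v]) (auto simp: neighbors_def)
    show "closed_segment v ` neighbors P v = {e. e edge_of P \<and> v \<in> e}"
    proof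
      show "closed_segment v ` neighbors P v \<subseteq> {e. e edge_of P \<and> v \<in> e}"
        by (auto simp: neighbors_def adj_def)
      show "{e. e edge_of P \<and> v \<in> e} \<subseteq> closed_segment v ` neighbors P v"
      proof
        fix e assume "e \<in> {e. e edge_of P \<and> v \<in> e}"
        then obtain w where "e = closed_segment v w" "adj P v w"
          using edge_through_vertex[OF assms(1) _ assms(2), of e] by blast
        then show "e \<in> closed_segment v ` neighbors P v" by (auto simp: neighbors_def)
      qed
    qed
  qed
  then show ?thesis by (simp add: vertex_degree_def bij_betw_same_card)
qed

section \<open>Matching edges through the 2-faces at an edge\<close>

context
  fixes P :: "'a::euclidean_space set"
  assumes P: "polytope P"
begin

lemma two_face_adj:
  assumes "adj P u v" "F \<in> two_faces_above P (closed_segment u v)"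
  shows "F face_of P" "polytope F" "aff_dim F = 2" "adj F u v"
proof -
  show F: "F face_of P" "aff_dim F = 2" using assms by (auto simp: two_faces_above_def)
  show "polytope F" using F P face_of_polytope_polytope by blast
  have "u \<in> F" "v \<in> F" using assms by (auto simp: two_faces_above_def)
  then show "adj F u v" using assms adj_face[OF F(1)] by blast
qed

lemma next_neighbor:
  assumes "adj P u v" "F \<in> two_faces_above P (closed_segment u v)"
  shows "adj F u (next_neighbor F u v)" "next_neighbor F u v \<noteq> v"
    and "adj F u w \<Longrightarrow> w \<noteq> v \<Longrightarrow> next_neighbor F u v = w"
proof -
  have ex1: "\<exists>!w. adj F u w \<and> w \<noteq> v"
    using polygon_other_neighbor two_face_adj[OF assms] by blast
  show "adj F u (next_neighbor F u v)" "next_neighbor F u v \<noteq> v"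
    unfolding next_neighbor_def using theI'[OF ex1] by simp_all
  show "next_neighbor F u v = w" if "adj F u w" "w \<noteq> v"
    unfolding next_neighbor_def using the1_equality[OF ex1] that by simp
qed

text \<open>Distinct 2-faces meet in a face of dimension at most one, so an edge in both is the
  whole intersection.\<close>

lemma two_faces_share_one_edge:
  assumes F: "F face_of P" "aff_dim F = 2" "F' face_of P" "aff_dim F' = 2" "F \<noteq> F'"
    and e: "e edge_of P" "e' edge_of P" "e \<subseteq> F" "e \<subseteq> F'" "e' \<subseteq> F" "e' \<subseteq> F'"
  shows "e = e'"
proof -
  have conv: "convex F" "convex P" using F P face_of_imp_convex polytope_imp_convex by blast+
  have I: "F \<inter> F' face_of P" using F face_of_Int by blast
  have neq: "F \<inter> F' \<noteq> F"
    using equal_dim_face_eq[OF conv(2) F(1) F(3) _] F(2,4,5) by auto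
  have "aff_dim (F \<inter> F') < aff_dim F"
    using neq I by (intro face_of_aff_dim_lt conv(1)) (simp_all add: face_of_face[OF F(1)])
  moreover have "1 \<le> aff_dim (F \<inter> F')"
    using aff_dim_subset[of e "F \<inter> F'"] e by (auto simp: edge_of_def)
  ultimately have "aff_dim (F \<inter> F') = 1" using F by simp
  then have "e = F \<inter> F'" "e' = F \<inter> F'"
    using equal_dim_face_eq[OF conv(2) _ I] e by (auto simp: edge_of_def)
  then show ?thesis by simp
qed

text \<open>Two 2-faces with the same next neighbor \<open>w\<close> would share both edges
  \<open>uv\<close> and \<open>uw\<close>.\<close>

lemma next_neighbor_inj:
  assumes uv: "adj P u v"
  shows "inj_on (\<lambda>F. next_neighbor F u v) (two_faces_above P (closed_segment u v))"
proof (rule inj_onI, rule ccontr)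
  fix F G assume F: "F \<in> two_faces_above P (closed_segment u v)"
    and G: "G \<in> two_faces_above P (closed_segment u v)"
    and eq: "next_neighbor F u v = next_neighbor G u v" and "F \<noteq> G"
  let ?w = "next_neighbor F u v"
  note FP = two_face_adj[OF uv F] and GP = two_face_adj[OF uv G]
  have wF: "adj F u ?w" and wG: "adj G u ?w" and "?w \<noteq> v"
    using next_neighbor(1,2)[OF uv F] next_neighbor(1)[OF uv G] unfolding eq by auto
  have w: "adj P u ?w" using wF unfolding adj_face[OF FP(1)] by blast
  have "closed_segment u ?w \<subseteq> F" "closed_segment u ?w \<subseteq> G"
    "closed_segment u v \<subseteq> F" "closed_segment u v \<subseteq> G"
    using wF wG FP(4) GP(4) unfolding adj_def by (blast dest: edge_of_imp_subset)+
  then have "closed_segment u v = closed_segment u ?w"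
    using uv w unfolding adj_def
    by (intro two_faces_share_one_edge[OF FP(1,3) GP(1,3) \<open>F \<noteq> G\<close>])
  then show False using adj_segment_inj[OF uv w] \<open>?w \<noteq> v\<close> by simp
qed

text \<open>A neighbor of \<open>u\<close> other than \<open>v\<close> either spans with
  \<open>uv\<close> a 2-face, of which it is then the next neighbor, or is stray. Injectivity turns
  the first kind into a sum over 2-faces.\<close>

lemma sum_neighbors:
  fixes f :: "'a \<Rightarrow> int"
  assumes uv: "adj P u v"
  shows "(\<Sum>w\<in>neighbors P u. f w) =
    f v + (\<Sum>F\<in>two_faces_above P (closed_segment u v). f (next_neighbor F u v))
    + (\<Sum>w\<in>stray_neighbors P u v. f w)"
proof -
  let ?F = "two_faces_above P (closed_segment u v)"
  let ?g = "\<lambda>F. next_neighbor F u v"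
  have common: "in_common_two_face P (closed_segment u v) (closed_segment u w) \<longleftrightarrow> w \<in> ?g ` ?F"
    if w: "w \<in> neighbors P u" "w \<noteq> v" for w
  proof
    assume "in_common_two_face P (closed_segment u v) (closed_segment u w)"
    then obtain F where F: "F \<in> ?F" "closed_segment u w \<subseteq> F"
      unfolding in_common_two_face_def two_faces_above_def by blast
    then have "adj F u w"
      using w adj_face[OF two_face_adj(1)[OF uv F(1)]] by (auto simp: neighbors_def)
    then show "w \<in> ?g ` ?F" using next_neighbor(3)[OF uv F(1)] F(1) w(2) by blast
  next
    assume "w \<in> ?g ` ?F"
    then obtain F where F: "F \<in> ?F" "w = ?g F" by blast
    have "adj F u w" using F next_neighbor(1)[OF uv F(1)] by blast
    then have "closed_segment u w \<subseteq> F" by (auto simp: adj_def dest: edge_of_imp_subset)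
    then show "in_common_two_face P (closed_segment u v) (closed_segment u w)"
      using F(1) unfolding in_common_two_face_def two_faces_above_def by blast
  qed
  have gN: "?g ` ?F \<subseteq> neighbors P u"
    using next_neighbor(1)[OF uv] adj_face[OF two_face_adj(1)[OF uv]] by (auto simp: neighbors_def)
  have vN: "v \<in> neighbors P u" using uv by (simp add: neighbors_def)
  have vg: "v \<notin> ?g ` ?F"
  proof
    assume "v \<in> ?g ` ?F"
    then obtain F where "v = ?g F" "F \<in> ?F" by (rule imageE)
    then show False using next_neighbor(2)[OF uv] by metis
  qed
  have eq: "neighbors P u = insert v (?g ` ?F) \<union> stray_neighbors P u v"
    using common gN vN by (auto simp: stray_neighbors_def)
  have disj: "insert v (?g ` ?F) \<inter> stray_neighbors P u v = {}"
    using common by (auto simp: stray_neighbors_def)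
  have fin: "finite ?F" "finite (stray_neighbors P u v)"
    using finite_two_faces_above[OF P] finite_neighbors[OF P, of u]
    by (auto simp: stray_neighbors_def)
  show ?thesis
    unfolding eq using fin disj vg
    by (simp add: sum.union_disjoint sum.reindex[OF next_neighbor_inj[OF uv]])
qed

text \<open>The three families of edges consist of parallel neighbors of \<open>e\<close> and do not
  overlap: stray edges share a vertex but no 2-face with \<open>e\<close>, far edges the reverse,
  and an edge through both \<open>u\<close> and \<open>v\<close> is \<open>e\<close>.\<close>

lemma parallel_neighbors_bound:
  assumes uv: "adj P u v"
  defines "e \<equiv> closed_segment u v"
  shows "card (stray_neighbors P u v) + card (stray_neighbors P v u)
      + (\<Sum>F\<in>two_faces_above P e. card (far_edges P e F)) \<le> card (parallel_neighbors P e)"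
proof -
  let ?A = "closed_segment u ` stray_neighbors P u v"
  let ?B = "closed_segment v ` stray_neighbors P v u"
  let ?C = "\<Union>F\<in>two_faces_above P e. far_edges P e F"
  have uvV: "u extreme_point_of P" "v extreme_point_of P"
    using adj_vertices[OF uv] by (auto simp: vertices_def)
  have e: "e edge_of P" using uv by (simp add: adj_def e_def)
  have fin: "finite X" if "X \<subseteq> {e. e edge_of P}" for X
    using that finite_edges[OF P] finite_subset by blast
  have AE: "?A \<subseteq> {e'. e' edge_of P \<and> u \<in> e' \<and> \<not> in_common_two_face P e e'}"
    by (auto simp: stray_neighbors_def neighbors_def adj_def e_def)
  have BE: "?B \<subseteq> {e'. e' edge_of P \<and> v \<in> e' \<and> \<not> in_common_two_face P e e'}"
    by (auto simp: stray_neighbors_def neighbors_def adj_def e_def closed_segment_commute)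
  have CE: "?C \<subseteq> {e'. e' edge_of P \<and> \<not> share_vertex P e e' \<and> in_common_two_face P e e'}"
    by (auto simp: far_edges_def two_faces_above_def in_common_two_face_def)
  have uve: "u \<in> e" "v \<in> e" by (auto simp: e_def)
  have both: "e' = e" if e': "e' edge_of P" "u \<in> e'" "v \<in> e'" for e'
  proof -
    obtain w where w: "e' = closed_segment u w" "adj P u w"
      using adj_vertices[OF uv] by (blast intro: edge_through_vertex[OF P e'(1) _ e'(2)])
    have "v = u \<or> v = w"
      using edge_vertex[OF w(2)] adj_vertices[OF uv] e'(3) unfolding w(1) by blast
    then show ?thesis using w(1) adj_neq[OF uv] by (auto simp: e_def)
  qed
  have eA: "e \<notin> ?A"
    unfolding stray_neighbors_def neighbors_def e_def using adj_segment_inj[OF uv] by blast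
  have eB: "e \<notin> ?B"
    unfolding stray_neighbors_def neighbors_def e_def closed_segment_commute[of u v]
    using adj_segment_inj[OF adj_sym[OF uv]] by blast
  have AB: "?A \<inter> ?B = {}" using AE BE both eA by blast
  have ABC: "(?A \<union> ?B) \<inter> ?C = {}" using AE BE CE by blast
  have cardC: "card ?C = (\<Sum>F\<in>two_faces_above P e. card (far_edges P e F))"
  proof (rule card_UN_disjoint)
    show "finite (two_faces_above P e)" by (rule finite_two_faces_above[OF P])
    show "\<forall>F\<in>two_faces_above P e. finite (far_edges P e F)"
      by (auto simp: far_edges_def intro: fin)
    \<comment> \<open>Distinct 2-faces through \<open>e\<close> share no further edge, and
      \<open>e\<close> is not far from itself.\<close>
    have "far_edges P e F \<inter> far_edges P e G = {}"
      if FG: "F \<in> two_faces_above P e" "G \<in> two_faces_above P e" "F \<noteq> G" for F G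
    proof (rule ccontr)
      assume "\<not> ?thesis"
      then obtain e' where e': "e' edge_of P" "e' \<subseteq> F" "e' \<subseteq> G" "\<not> share_vertex P e e'"
        unfolding far_edges_def by blast
      then have "e = e'" using two_faces_share_one_edge[of F G e e'] FG e
        by (auto simp: two_faces_above_def)
      then show False using e'(4) uvV uve by (auto simp: share_vertex_def)
    qed
    then show "\<forall>F\<in>two_faces_above P e. \<forall>G\<in>two_faces_above P e.
        F \<noteq> G \<longrightarrow> far_edges P e F \<inter> far_edges P e G = {}" by blast
  qed
  have inj: "inj_on (closed_segment x) (stray_neighbors P x y)" for x y
  proof (rule inj_onI)
    fix w w' assume "w \<in> stray_neighbors P x y" "w' \<in> stray_neighbors P x y"
      and eq: "closed_segment x w = closed_segment x w'"
    then have "adj P x w" "adj P x w'" by (simp_all add: stray_neighbors_def neighbors_def)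
    then show "w = w'" using eq by (rule adj_segment_inj)
  qed
  have finA: "finite ?A" using AE by (intro fin) blast
  have finB: "finite ?B" using BE by (intro fin) blast
  have finC: "finite ?C" using CE by (intro fin) blast
  have "card (?A \<union> ?B \<union> ?C) = card ?A + card ?B + card ?C"
    using card_Un_disjoint[OF finite_UnI[OF finA finB] finC ABC] card_Un_disjoint[OF finA finB AB]
    by linarith
  then have "card (stray_neighbors P u v) + card (stray_neighbors P v u)
      + (\<Sum>F\<in>two_faces_above P e. card (far_edges P e F)) = card (?A \<union> ?B \<union> ?C)"
    unfolding cardC card_image[OF inj] by (rule sym)
  also have "\<dots> \<le> card (parallel_neighbors P e)"
  proof (rule card_mono)
    show "finite (parallel_neighbors P e)" by (rule fin) (auto simp: parallel_neighbors_def)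
    have "e \<notin> ?C" using uvV uve by (auto simp: far_edges_def share_vertex_def)
    then have "?C \<subseteq> parallel_neighbors P e" using CE unfolding parallel_neighbors_def by blast
    moreover have "?A \<subseteq> parallel_neighbors P e"
    proof
      fix e' assume e': "e' \<in> ?A"
      then have "share_vertex P e e'" using AE uvV(1) uve(1) unfolding share_vertex_def by blast
      then show "e' \<in> parallel_neighbors P e"
        using e' AE eA unfolding parallel_neighbors_def by blast
    qed
    moreover have "?B \<subseteq> parallel_neighbors P e"
    proof
      fix e' assume e': "e' \<in> ?B"
      then have "share_vertex P e e'" using BE uvV(2) uve(2) unfolding share_vertex_def by blast
      then show "e' \<in> parallel_neighbors P e"
        using e' BE eB unfolding parallel_neighbors_def by blast
    qed
    ultimately show "?A \<union> ?B \<union> ?C \<subseteq> parallel_neighbors P e" by (intro Un_least)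
  qed
  finally show ?thesis .
qed

text \<open>Off the edge \<open>uv\<close> the graph of the polygon \<open>F\<close> stays
  connected, so its two next neighbors are joined by a path avoiding \<open>u\<close> and
  \<open>v\<close>. All edges of that path are far from \<open>uv\<close>, and \<delta> rises by at
  most one along each. In a triangle the two next neighbors coincide.\<close>

lemma polygon_detour:
  fixes \<delta> :: "'a \<Rightarrow> int"
  assumes uv: "adj P u v" and F: "F \<in> two_faces_above P (closed_segment u v)"
    and lip: "\<And>x y. adj P x y \<Longrightarrow> \<delta> y \<le> \<delta> x + 1"
  shows "\<delta> (next_neighbor F v u) - \<delta> (next_neighbor F u v)
    \<le> int (card (far_edges P (closed_segment u v) F))"
proof -
  let ?e = "closed_segment u v"
  let ?x = "next_neighbor F u v" and ?y = "next_neighbor F v u"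
  note FP = two_face_adj[OF uv F]
  have F': "F \<in> two_faces_above P (closed_segment v u)" using F by (simp add: closed_segment_commute)
  have x: "adj F u ?x" "?x \<noteq> v" by (rule next_neighbor[OF uv F])+
  have y: "adj F v ?y" "?y \<noteq> u" by (rule next_neighbor[OF adj_sym[OF uv] F'])+
  have xV: "?x \<in> vertices F" "?x \<noteq> u" using adj_vertices[OF x(1)] adj_neq[OF x(1)] by auto
  have yV: "?y \<in> vertices F" "?y \<noteq> v" using adj_vertices[OF y(1)] adj_neq[OF y(1)] by auto
  have xe: "?x \<notin> ?e" using edge_vertex[OF FP(4) xV(1)] xV(2) x(2) by blast
  have ye: "?y \<notin> ?e" using edge_vertex[OF FP(4) yV(1)] yV(2) y(2) by blast
  have eF: "?e face_of F" using FP(4) by (simp add: adj_def edge_of_def)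
  have path: "(\<lambda>x y. adj F x y \<and> x \<notin> ?e \<and> y \<notin> ?e)\<^sup>*\<^sup>* ?x ?y"
    by (rule connected_off_face[OF FP(2) eF xV(1) xe yV(1) ye])
  have fin: "finite (far_edges P ?e F)"
    by (rule finite_subset[OF _ finite_edges[OF P]]) (auto simp: far_edges_def)
  have step: "adj P z w \<and> closed_segment z w \<in> far_edges P ?e F \<and> \<delta> w \<le> \<delta> z + 1"
    if zw: "adj F z w \<and> z \<notin> ?e \<and> w \<notin> ?e" for z w
  proof -
    have a: "adj P z w" using zw adj_face[OF FP(1)] by blast
    have "closed_segment z w \<subseteq> F" using zw by (auto simp: adj_def dest: edge_of_imp_subset)
    moreover have "\<not> share_vertex P ?e (closed_segment z w)"
    proof
      assume "share_vertex P ?e (closed_segment z w)"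
      then obtain p where p: "p \<in> vertices P" "p \<in> ?e" "p \<in> closed_segment z w"
        unfolding share_vertex_def vertices_def by blast
      then show False using edge_vertex[OF a p(1,3)] zw by blast
    qed
    ultimately show ?thesis using lip[OF a] a by (simp add: far_edges_def adj_def)
  qed
  show ?thesis by (rule lipschitz_path_bound[OF fin path step])
qed

text \<open>The edges at \<open>u\<close> are matched with those at \<open>v\<close> through the 2-faces containing \<open>uv\<close>;
  all unmatched edges are parallel neighbors of \<open>uv\<close>.\<close>

lemma laplacian_drop:
  fixes \<delta> :: "'a \<Rightarrow> int"
  assumes uv: "adj P u v" and step: "\<delta> v = \<delta> u + 1"
    and lip: "\<And>x y. adj P x y \<Longrightarrow> \<delta> y \<le> \<delta> x + 1"
  shows "(\<Sum>w\<in>neighbors P v. \<delta> w - \<delta> v) + forman_ricci_curvature P (closed_segment u v)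
    \<le> (\<Sum>w\<in>neighbors P u. \<delta> w - \<delta> u)"
proof -
  let ?e = "closed_segment u v"
  let ?F = "two_faces_above P ?e"
  let ?U = "stray_neighbors P u v" and ?V = "stray_neighbors P v u"
  let ?x = "\<lambda>F. next_neighbor F u v" and ?y = "\<lambda>F. next_neighbor F v u"
  note vu = adj_sym[OF uv]
  \<comment> \<open>The summands -1 here and 1 in the next sum come from \<open>u\<close> and
    \<open>v\<close> themselves; their difference supplies the 2 in the curvature.\<close>
  have "(\<Sum>w\<in>neighbors P v. \<delta> w - \<delta> v)
      = -1 + (\<Sum>F\<in>?F. \<delta> (?y F) - \<delta> v) + (\<Sum>w\<in>?V. \<delta> w - \<delta> v)"
    using sum_neighbors[OF vu, of "\<lambda>w. \<delta> w - \<delta> v"] step by (simp add: closed_segment_commute)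
  moreover have "(\<Sum>w\<in>neighbors P u. \<delta> w - \<delta> u)
      = 1 + (\<Sum>F\<in>?F. \<delta> (?x F) - \<delta> u) + (\<Sum>w\<in>?U. \<delta> w - \<delta> u)"
    using sum_neighbors[OF uv, of "\<lambda>w. \<delta> w - \<delta> u"] step by simp
  moreover have "(\<Sum>w\<in>?V. \<delta> w - \<delta> v) \<le> of_nat (card ?V) * 1"
    by (rule sum_bounded_above) (use lip in \<open>force simp: stray_neighbors_def neighbors_def\<close>)
  moreover have "of_nat (card ?U) * (-1) \<le> (\<Sum>w\<in>?U. \<delta> w - \<delta> u)"
    by (rule sum_bounded_below)
      (use lip adj_sym in \<open>force simp: stray_neighbors_def neighbors_def\<close>)
  \<comment> \<open>Face by face, the detour bound applies; the -1 is
    \<open>\<delta> u - \<delta> v\<close>, and summing it yields the number of 2-faces in the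
    curvature.\<close>
  moreover have "(\<Sum>F\<in>?F. \<delta> (?y F) - \<delta> v) - (\<Sum>F\<in>?F. \<delta> (?x F) - \<delta> u)
      \<le> (\<Sum>F\<in>?F. int (card (far_edges P ?e F)) - 1)"
    unfolding sum_subtractf[symmetric]
  proof (rule sum_mono)
    fix F assume F: "F \<in> ?F"
    show "\<delta> (?y F) - \<delta> v - (\<delta> (?x F) - \<delta> u) \<le> int (card (far_edges P ?e F)) - 1"
      using polygon_detour[OF uv F, of \<delta>, OF lip] step by linarith
  qed
  moreover have "(\<Sum>F\<in>?F. int (card (far_edges P ?e F)) - 1)
      = int (\<Sum>F\<in>?F. card (far_edges P ?e F)) - int (card ?F)"
    by (simp add: sum_subtractf)
  moreover have "int (card ?U) + int (card ?V) + int (\<Sum>F\<in>?F. card (far_edges P ?e F))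
      \<le> int (card (parallel_neighbors P ?e))"
    using parallel_neighbors_bound[OF uv] by linarith
  ultimately show ?thesis unfolding forman_ricci_curvature_def by linarith
qed

text \<open>With f 2-faces through \<open>uv\<close>, positivity leaves at most f + 1 stray
  neighbors at \<open>v\<close>. Hence \<open>v\<close> has degree at most 2 (f + 1), while
  \<open>u\<close> has degree at least f + 1.\<close>

lemma degree_doubling:
  assumes uv: "adj P u v" and pos: "forman_ricci_curvature P (closed_segment u v) > 0"
  shows "card (neighbors P v) \<le> 2 * card (neighbors P u)"
proof -
  let ?F = "two_faces_above P (closed_segment u v)"
  have "int (card (neighbors P u)) = 1 + int (card ?F) + int (card (stray_neighbors P u v))"
    using sum_neighbors[OF uv, of "\<lambda>_. 1"] by simp
  moreover have "int (card (neighbors P v)) = 1 + int (card ?F) + int (card (stray_neighbors P v u))"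
    using sum_neighbors[OF adj_sym[OF uv], of "\<lambda>_. 1"] by (simp add: closed_segment_commute)
  moreover have "int (card (stray_neighbors P v u)) \<le> int (card (parallel_neighbors P (closed_segment u v)))"
    using parallel_neighbors_bound[OF uv] by linarith
  ultimately show ?thesis using pos unfolding forman_ricci_curvature_def by linarith
qed

end

section \<open>Bounding the number of vertices\<close>

definition graph_distance :: "'a::euclidean_space set \<Rightarrow> 'a \<Rightarrow> 'a \<Rightarrow> nat" where
  "graph_distance P x y = (LEAST n. (adj P ^^ n) x y)"

context
  fixes P :: "'a::euclidean_space set" and x\<^sub>0 :: 'a
  assumes P: "polytope P" and x\<^sub>0: "x\<^sub>0 \<in> vertices P"
begin

lemma graph_distance_path:
  assumes "x \<in> vertices P"
  shows "(adj P ^^ graph_distance P x\<^sub>0 x) x\<^sub>0 x"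
  unfolding graph_distance_def
  by (rule LeastI_ex) (use graph_connected[OF P x\<^sub>0 assms] rtranclp_imp_relpowp in metis)

lemma graph_distance_adj:
  assumes "adj P x y"
  shows "graph_distance P x\<^sub>0 y \<le> Suc (graph_distance P x\<^sub>0 x)"
proof -
  have "(adj P ^^ Suc (graph_distance P x\<^sub>0 x)) x\<^sub>0 y"
    using graph_distance_path adj_vertices[OF assms] assms by (metis relpowp_Suc_I)
  then show ?thesis unfolding graph_distance_def[of P x\<^sub>0 y] by (rule Least_le)
qed

lemma graph_distance_0:
  assumes "x \<in> vertices P" "graph_distance P x\<^sub>0 x = 0"
  shows "x = x\<^sub>0"
  using graph_distance_path[OF assms(1)] assms(2) by simp

text \<open>Take the last vertex before \<open>y\<close> on a shortest path.\<close>

lemma graph_distance_Suc: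
  assumes "y \<in> vertices P" "graph_distance P x\<^sub>0 y = Suc n"
  obtains u where "adj P u y" "graph_distance P x\<^sub>0 u = n"
proof -
  have "(adj P ^^ Suc n) x\<^sub>0 y" using graph_distance_path assms by metis
  then obtain u where u: "(adj P ^^ n) x\<^sub>0 u" "adj P u y" by (rule relpowp_Suc_E)
  have "graph_distance P x\<^sub>0 u \<le> n" unfolding graph_distance_def using u(1) by (rule Least_le)
  then show ?thesis using that u(2) graph_distance_adj[OF u(2)] assms by auto
qed

text \<open>Along a shortest path \<delta> rises by one per edge, so \<Phi> falls by at least the
  curvature, a positive integer. At both ends the Lipschitz property bounds \<Phi> in absolute value
  by the degree.\<close>

lemma graph_distance_le_degrees:
  assumes pos: "forman_ricci_positive P" and "y \<in> vertices P"
  shows "graph_distance P x\<^sub>0 y \<le> card (neighbors P x\<^sub>0) + card (neighbors P y)"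
proof -
  define \<delta> where "\<delta> x = int (graph_distance P x\<^sub>0 x)" for x
  define \<Phi> where "\<Phi> x = (\<Sum>w\<in>neighbors P x. \<delta> w - \<delta> x)" for x
  have lip: "\<delta> w \<le> \<delta> x + 1" if "adj P x w" for x w
    using graph_distance_adj[OF that] by (simp add: \<delta>_def)
  have "\<Phi> y + int n \<le> \<Phi> x\<^sub>0" if "y \<in> vertices P" "graph_distance P x\<^sub>0 y = n" for y n
    using that
  proof (induction n arbitrary: y)
    case 0
    then show ?case using graph_distance_0 by auto
  next
    case (Suc n)
    obtain u where u: "adj P u y" "graph_distance P x\<^sub>0 u = n"
      using graph_distance_Suc[OF Suc.prems] by metis
    have "forman_ricci_curvature P (closed_segment u y) > 0"
      using pos u(1) by (auto simp: forman_ricci_positive_def adj_def)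
    moreover have "\<Phi> y + forman_ricci_curvature P (closed_segment u y) \<le> \<Phi> u"
      unfolding \<Phi>_def using Suc.prems u
      by (intro laplacian_drop[OF P] lip) (auto simp: \<delta>_def)
    moreover have "\<Phi> u + int n \<le> \<Phi> x\<^sub>0" using Suc.IH u adj_vertices by blast
    ultimately show ?case by simp
  qed
  then have "\<Phi> y + \<delta> y \<le> \<Phi> x\<^sub>0" using assms(2) by (simp add: \<delta>_def)
  moreover have "\<Phi> x\<^sub>0 \<le> of_nat (card (neighbors P x\<^sub>0)) * 1"
    unfolding \<Phi>_def by (rule sum_bounded_above) (use lip in \<open>force simp: neighbors_def\<close>)
  moreover have "of_nat (card (neighbors P y)) * (-1) \<le> \<Phi> y"
    unfolding \<Phi>_def
    by (rule sum_bounded_below) (use lip adj_sym in \<open>force simp: neighbors_def\<close>)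
  ultimately show ?thesis unfolding \<delta>_def by linarith
qed

lemma degree_growth:
  assumes pos: "forman_ricci_positive P" and "y \<in> vertices P" "graph_distance P x\<^sub>0 y = n"
  shows "card (neighbors P y) \<le> 2 ^ n * card (neighbors P x\<^sub>0)"
  using assms(2,3)
proof (induction n arbitrary: y)
  case 0
  then show ?case using graph_distance_0 by auto
next
  case (Suc n)
  obtain u where u: "adj P u y" "graph_distance P x\<^sub>0 u = n"
    using graph_distance_Suc[OF Suc.prems] by metis
  have "card (neighbors P y) \<le> 2 * card (neighbors P u)"
    using degree_doubling[OF P u(1)] pos u(1) by (auto simp: forman_ricci_positive_def adj_def)
  also have "\<dots> \<le> 2 * (2 ^ n * card (neighbors P x\<^sub>0))"
    using Suc.IH[of u] u adj_vertices by auto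
  finally show ?case by simp
qed

text \<open>Each vertex of a ball contributes itself and its neighbors to the next ball. The fixed
  radius \<open>m\<close> makes the degree bound \<open>2 ^ m * k\<close> uniform throughout the
  induction on \<open>n\<close>.\<close>

lemma card_graph_ball:
  assumes pos: "forman_ricci_positive P" and k: "card (neighbors P x\<^sub>0) \<le> k" and "n \<le> m"
  shows "card {x \<in> vertices P. graph_distance P x\<^sub>0 x \<le> n} \<le> (1 + 2 ^ m * k) ^ n"
  using \<open>n \<le> m\<close>
proof (induction n)
  case 0
  have "card {x \<in> vertices P. graph_distance P x\<^sub>0 x \<le> 0} \<le> card {x\<^sub>0}"
    by (rule card_mono) (auto intro: graph_distance_0)
  then show ?case by simp
next
  case (Suc n)
  let ?B = "\<lambda>n. {x \<in> vertices P. graph_distance P x\<^sub>0 x \<le> n}"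
  have fin: "finite (?B n)" for n using finite_vertices[OF P] by simp
  have "?B (Suc n) \<subseteq> (\<Union>x\<in>?B n. insert x (neighbors P x))"
  proof
    fix y assume y: "y \<in> ?B (Suc n)"
    show "y \<in> (\<Union>x\<in>?B n. insert x (neighbors P x))"
    proof (cases "graph_distance P x\<^sub>0 y = Suc n")
      case True
      then obtain u where "adj P u y" "graph_distance P x\<^sub>0 u = n"
        using graph_distance_Suc y by blast
      then have "u \<in> ?B n" "y \<in> neighbors P u" by (auto simp: neighbors_def dest: adj_vertices)
      then show ?thesis by blast
    qed (use y in auto)
  qed
  then have "card (?B (Suc n)) \<le> card (\<Union>x\<in>?B n. insert x (neighbors P x))"
    by (intro card_mono) (auto simp: fin finite_neighbors[OF P])
  also have "\<dots> \<le> (\<Sum>x\<in>?B n. card (insert x (neighbors P x)))"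
    by (rule card_UN_le[OF fin])
  also have "\<dots> \<le> of_nat (card (?B n)) * (1 + 2 ^ m * k)"
  proof (rule sum_bounded_above)
    fix x assume x: "x \<in> ?B n"
    have "card (insert x (neighbors P x)) \<le> 1 + card (neighbors P x)"
      using finite_neighbors[OF P] by (simp add: card_insert_if)
    also have "card (neighbors P x) \<le> 2 ^ graph_distance P x\<^sub>0 x * card (neighbors P x\<^sub>0)"
      using degree_growth[OF pos] x by blast
    also have "\<dots> \<le> 2 ^ m * k"
      using x k Suc.prems by (intro mult_mono power_increasing) auto
    finally show "card (insert x (neighbors P x)) \<le> 1 + 2 ^ m * k" by simp
  qed
  also have "\<dots> \<le> (1 + 2 ^ m * k) ^ n * (1 + 2 ^ m * k)"
    using Suc by (intro mult_right_mono) auto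
  finally show ?case unfolding power_Suc2 .
qed

end

text \<open>The total degree is below k + 1 times the number of vertices. So some vertex has degree
  at most \<open>k\<close>, and fewer than half of the vertices have degree at least 2 (k + 1); the
  others lie in a ball of bounded size.\<close>

lemma few_vertices:
  assumes P: "polytope P" and pos: "forman_ricci_positive P" and avg: "average_vertex_degree P \<le> \<Delta>"
    and k: "\<Delta> < real k + 1"
  shows "card (vertices P) \<le> 2 * (1 + 2 ^ (3 * k + 1) * k) ^ (3 * k + 1)"
proof (cases "vertices P = {}")
  case False
  let ?V = "vertices P" and ?deg = "\<lambda>v. card (neighbors P v)"
  have fin: "finite ?V" using finite_vertices P by blast
  then have cpos: "card ?V > 0" using False by (simp add: card_gt_0_iff)
  have "average_vertex_degree P = (\<Sum>v\<in>?V. real (?deg v)) / real (card ?V)"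
    using vertex_degree_neighbors[OF P] by (simp add: average_vertex_degree_def vertices_def)
  then have "(\<Sum>v\<in>?V. real (?deg v)) \<le> \<Delta> * card ?V"
    using avg cpos by (simp add: pos_divide_le_eq)
  also have "\<dots> < (real k + 1) * card ?V" using k cpos by simp
  finally have "real (\<Sum>v\<in>?V. ?deg v) < real ((k + 1) * card ?V)" by (simp add: algebra_simps)
  then have sum: "(\<Sum>v\<in>?V. ?deg v) < (k + 1) * card ?V" by linarith
  have "\<exists>v\<in>?V. ?deg v \<le> k"
  proof (rule ccontr)
    assume "\<not> ?thesis"
    then have "k + 1 \<le> ?deg v" if "v \<in> ?V" for v using that by (simp add: not_le Suc_le_eq)
    then have "of_nat (card ?V) * (k + 1) \<le> (\<Sum>v\<in>?V. ?deg v)" by (intro sum_bounded_below) auto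
    then show False using sum by (simp add: algebra_simps)
  qed
  then obtain x\<^sub>0 where x\<^sub>0: "x\<^sub>0 \<in> ?V" "?deg x\<^sub>0 \<le> k" by blast
  \<comment> \<open>Outside this ball the distance is at least 3 k + 2; subtracting the degree of
    \<open>x\<^sub>0\<close>, at most \<open>k\<close>, leaves degree at least 2 (k + 1).\<close>
  let ?B = "{x \<in> ?V. graph_distance P x\<^sub>0 x \<le> 3 * k + 1}"
  have "of_nat (card (?V - ?B)) * (2 * (k + 1)) \<le> (\<Sum>v\<in>?V - ?B. ?deg v)"
  proof (rule sum_bounded_below)
    fix v assume "v \<in> ?V - ?B"
    then show "2 * (k + 1) \<le> ?deg v"
      using graph_distance_le_degrees[OF P x\<^sub>0(1) pos, of v] x\<^sub>0(2) by auto
  qed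
  also have "\<dots> \<le> (\<Sum>v\<in>?V. ?deg v)" by (rule sum_mono2[OF fin]) auto
  finally have "(k + 1) * (2 * card (?V - ?B)) < (k + 1) * card ?V"
    using sum by (simp add: algebra_simps)
  then have "2 * card (?V - ?B) < card ?V" by (simp only: mult_less_cancel1)
  moreover have "card (?V - ?B) = card ?V - card ?B" using fin by (intro card_Diff_subset) auto
  ultimately have "card ?V \<le> 2 * card ?B" by linarith
  also have "card ?B \<le> (1 + 2 ^ (3 * k + 1) * k) ^ (3 * k + 1)"
    by (rule card_graph_ball[OF P x\<^sub>0(1) pos x\<^sub>0(2) order_refl])
  finally show ?thesis by simp
qed simp

section \<open>Finitely many face lattices\<close>

lemma face_subset_iff_vertices:
  assumes "polytope P" "F face_of P" "G face_of P"
  shows "F \<subseteq> G \<longleftrightarrow> vertices F \<subseteq> vertices G"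
proof
  show "F \<subseteq> G \<Longrightarrow> vertices F \<subseteq> vertices G" using vertices_face assms by blast
  assume "vertices F \<subseteq> vertices G"
  then have "convex hull vertices F \<subseteq> convex hull vertices G" by (rule hull_mono)
  then show "F \<subseteq> G" using polytope_hull_vertices face_of_polytope_polytope assms by metis
qed

text \<open>A face is the hull of its vertices, so inclusion of faces is inclusion of their label
  sets. When both polytopes have the same family of label sets, sending a face of \<open>P\<close>
  to the face of \<open>Q\<close> with the same labels is an isomorphism.\<close>

lemma combinatorially_equivalent_if_same_code:
  assumes P: "polytope P" and Q: "polytope Q"
    and g: "inj_on g (vertices P)" and h: "inj_on h (vertices Q)"
    and code: "(\<lambda>F. g ` vertices F) ` {F. F face_of P} = (\<lambda>G. h ` vertices G) ` {G. G face_of Q}"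
  shows "combinatorially_equivalent P Q"
proof -
  let ?a = "\<lambda>F. g ` vertices F" and ?b = "\<lambda>G. h ` vertices G"
  have a: "?a F \<subseteq> ?a F' \<longleftrightarrow> F \<subseteq> F'" if "F face_of P" "F' face_of P" for F F'
    using that g by (simp add: face_subset_iff_vertices[OF P] vertices_face inj_on_image_subset_iff)
  have b: "?b F \<subseteq> ?b F' \<longleftrightarrow> F \<subseteq> F'" if "F face_of Q" "F' face_of Q" for F F'
    using that h by (simp add: face_subset_iff_vertices[OF Q] vertices_face inj_on_image_subset_iff)
  have bij_a: "bij_betw ?a {F. F face_of P} (?a ` {F. F face_of P})"
    by (rule inj_on_imp_bij_betw, rule inj_onI) (use a in \<open>metis mem_Collect_eq subset_antisym order_refl\<close>)
  have bij_b: "bij_betw ?b {F. F face_of Q} (?b ` {F. F face_of Q})"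
    by (rule inj_on_imp_bij_betw, rule inj_onI) (use b in \<open>metis mem_Collect_eq subset_antisym order_refl\<close>)
  let ?\<phi> = "inv_into {G. G face_of Q} ?b \<circ> ?a"
  have bij: "bij_betw ?\<phi> {F. F face_of P} {G. G face_of Q}"
    using bij_betw_trans[OF bij_a[unfolded code] bij_betw_inv_into[OF bij_b]] .
  have \<phi>: "?\<phi> F face_of Q" "?b (?\<phi> F) = ?a F" if "F face_of P" for F
  proof -
    show "?\<phi> F face_of Q" using bij_betw_apply[OF bij] that by simp
    have "?a F \<in> ?b ` {G. G face_of Q}" using that code by blast
    then show "?b (?\<phi> F) = ?a F" unfolding comp_apply by (rule f_inv_into_f[of _ ?b])
  qed
  have "F \<subseteq> F' \<longleftrightarrow> ?\<phi> F \<subseteq> ?\<phi> F'" if "F face_of P" "F' face_of P" for F F'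
    using a[OF that] b[of "?\<phi> F" "?\<phi> F'"] \<phi>[OF that(1)] \<phi>[OF that(2)] by metis
  then show ?thesis using bij unfolding combinatorially_equivalent_def by blast
qed

text \<open>A class is determined by the code of any of its members, so the quotient is covered by
  an image of the finite set of codes.\<close>

lemma finite_quotient_if_finite_code:
  assumes fin: "finite (f ` A)" and sub: "r \<subseteq> A \<times> A" and equiv: "equiv A r"
    and code: "\<And>x y. x \<in> A \<Longrightarrow> y \<in> A \<Longrightarrow> f x = f y \<Longrightarrow> (x, y) \<in> r"
  shows "finite (A // r)"
proof -
  have "A // r \<subseteq> (\<lambda>c. r `` {inv_into A f c}) ` (f ` A)"
  proof
    fix X assume "X \<in> A // r"
    then obtain x where x: "x \<in> A" "X = r `` {x}" by (rule quotientE)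
    let ?y = "inv_into A f (f x)"
    have "?y \<in> A" "f ?y = f x" using x by (auto intro: inv_into_into f_inv_into_f)
    then have "X = r `` {?y}" using x code equiv_class_eq[OF equiv] by metis
    then show "X \<in> (\<lambda>c. r `` {inv_into A f c}) ` (f ` A)" using x by blast
  qed
  then show ?thesis using fin finite_subset by blast
qed

text \<open>Labelling the vertices by numbers below \<open>N\<close> encodes a face lattice as a
  family of subsets of \<open>{..<N}\<close>, and there are finitely many such families.\<close>

lemma finitely_many_types_with_few_vertices:
  fixes \<P> :: "'a::euclidean_space set set"
  assumes "\<And>P. P \<in> \<P> \<Longrightarrow> polytope P \<and> card (vertices P) \<le> N"
  shows "finite (\<P> // combinatorial_equivalence_on \<P>)"
proof -
  have "\<exists>g. inj_on g (vertices P) \<and> g ` vertices P \<subseteq> {..<N}" if "P \<in> \<P>" for P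
    using card_le_inj[of "vertices P" "{..<N}"] assms[OF that] finite_vertices by auto
  then obtain g where g: "\<And>P. P \<in> \<P> \<Longrightarrow> inj_on (g P) (vertices P)"
    "\<And>P. P \<in> \<P> \<Longrightarrow> g P ` vertices P \<subseteq> {..<N}"
    by metis
  let ?code = "\<lambda>P. (\<lambda>F. g P ` vertices F) ` {F. F face_of P}"
  show ?thesis
  proof (rule finite_quotient_if_finite_code[where f = ?code])
    have "?code P \<in> Pow (Pow {..<N})" if "P \<in> \<P>" for P
      using g(2)[OF that] vertices_face[of _ P] by fastforce
    then have "?code ` \<P> \<subseteq> Pow (Pow {..<N})" by blast
    then show "finite (?code ` \<P>)" by (rule finite_subset) simp
    show "(P, Q) \<in> combinatorial_equivalence_on \<P>"
      if "P \<in> \<P>" "Q \<in> \<P>" "?code P = ?code Q" for P Q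
      using combinatorially_equivalent_if_same_code[of P Q "g P" "g Q"] that g assms
      by (simp add: combinatorial_equivalence_on_def)
  qed (auto simp: combinatorial_equivalence_on_def intro: equiv_combinatorial_equivalence_on[unfolded combinatorial_equivalence_on_def])
qed

theorem theorem1p8:
  fixes d :: nat and \<Delta> :: real and \<P> :: "'a::euclidean_space set set"
  assumes "d \<ge> 3" and "\<Delta> \<ge> 3"
    and "\<P> = {P. polytope P \<and> aff_dim P = int d \<and> forman_ricci_positive P \<and>
                 average_vertex_degree P \<le> \<Delta>}"
  shows "finite (\<P> // combinatorial_equivalence_on \<P>)"
proof (rule finitely_many_types_with_few_vertices)
  fix P assume "P \<in> \<P>"
  \<comment> \<open>The integer part of \<Delta> serves as the degree bound
    \<open>k\<close>.\<close>
  have "\<Delta> < real (nat \<lfloor>\<Delta>\<rfloor>) + 1" by linarith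
  then show "polytope P \<and> card (vertices P)
      \<le> 2 * (1 + 2 ^ (3 * nat \<lfloor>\<Delta>\<rfloor> + 1) * nat \<lfloor>\<Delta>\<rfloor>) ^ (3 * nat \<lfloor>\<Delta>\<rfloor> + 1)"
    using few_vertices \<open>P \<in> \<P>\<close> assms(3) by blast
qed

end
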